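(* Let $\mathsf{R}$ be an ordered ring, $\mathsf{C} = \mathsf{R}(\mathrm{i})$ with $\mathrm{i}^2=-1$, let $\mathcal{D}$ be a $^*$-algebra over $\mathsf{C}$, let $\mathcal{H}$ be a right $\mathcal{D}$-module, and let $\mathcal{E} = \overline{\mathcal{H}} \otimes_{\mathsf{C}} \mathcal{H}$ be the associated $(\mathcal{D},\mathcal{D})$-bimodule with its antilinear involution $I: \mathcal{E}\to\mathcal{E}$, $I(\overline{x}\otimes y) = \overline{y}\otimes x$. Then a $\mathcal{D}$-valued inner product on $\mathcal{H}$ is equivalent to a $(\mathcal{D},\mathcal{D})$-bimodule map $\Phi: \mathcal{E} \to \mathcal{D}$ with $\Phi(z)^* = \Phi(I(z))$ for all $z \in \mathcal{E}$, via $$\langle x, y\rangle_{\mathcal{D}} = \Phi(\overline{x}\otimes y) \qquad (x,y\in\mathcal{H});$$ that is, this formula defines a bijection between the set of such bimodule maps $\Phi$ and the set of $\mathcal{D}$-valued inner products $\langle\cdot,\cdot\rangle_{\mathcal{D}}$ on $\mathcal{H}$. Moreover, $\langle\cdot,\cdot\rangle_{\mathcal{D}}$ is completely positive if and only if the corresponding map $\Phi$ is completely positive.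
   Context: **Rings and algebras.** $\mathsf{R}$ is an ordered ring (commutative, associative, unital, with a total order compatible with the ring operations), and $\mathsf{C}=\mathsf{R}(\mathrm{i})$ with $\mathrm{i}^2=-1$ carries the complex conjugation $\overline{a+\mathrm{i}b}=a-\mathrm{i}b$ for $a,b\in\mathsf{R}$. A $^*$-algebra over $\mathsf{C}$ is an associative $\mathsf{C}$-algebra (not necessarily unital) with a $\mathsf{C}$-antilinear involutive anti-automorphism $^*$. For a $^*$-algebra $\mathcal{D}$, $M_n(\mathcal{D})$ is the $^*$-algebra of $n\times n$ matrices with $(D^* )_{ij}=(D_{ji})^*$. Modules over $\mathcal{D}$ are always assumed to have an underlying compatible $\mathsf{C}$-module structure, and if $\mathcal{D}$ is unital its unit acts as the identity. **Positive elements.** A $\mathsf{C}$-linear functional $\omega:\mathcal{A}\to\mathsf{C}$ on a $^*$-algebra $\mathcal{A}$ is positive if $\omega(a^*a)\ge 0$ (i.e. $\omega(a^*a)$ lies in $\mathsf{R}$ and is $\geq 0$) for all $a\in\mathcal{A}$. Set $$\mathcal{A}^+=\{a\in\mathcal{A} : \omega(a)\ge 0 \text{ for all positive } \omega:\mathcal{A}\to\mathsf{C}\}.$$ In particular $M_n(\mathcal{D})^+$ is defined in this way for $\mathcal{A}=M_n(\mathcal{D})$. **Inner products.** A $\mathcal{D}$-valued inner product on a right $\mathcal{D}$-module $\mathcal{H}$ is a $\mathsf{C}$-sesquilinear map $\langle\cdot,\cdot\rangle_{\mathcal{D}}:\mathcal{H}\times\mathcal{H}\to\mathcal{D}$ (linear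 in the second argument, antilinear in the first) such that $\langle x,y\rangle_{\mathcal{D}}=(\langle y,x\rangle_{\mathcal{D}})^*$ and $\langle x,y\cdot d\rangle_{\mathcal{D}}=\langle x,y\rangle_{\mathcal{D}}\,d$ for all $x,y\in\mathcal{H}$, $d\in\mathcal{D}$. (Non-degeneracy is not required.) It is completely positive if $(\langle x_i,x_j\rangle_{\mathcal{D}})_{ij}\in M_n(\mathcal{D})^+$ for all $n\in\mathbb{N}$ and all $x_1,\dots,x_n\in\mathcal{H}$. **The bimodule $\mathcal{E}$.** The complex conjugate module $\overline{\mathcal{H}}$ equals $\mathcal{H}$ as an $\mathsf{R}$-module; writing $x\mapsto\overline{x}$ for the identity map $\mathcal{H}\to\overline{\mathcal{H}}$, its $\mathsf{C}$-module and left $\mathcal{D}$-module structures are $\alpha\overline{x}=\overline{x\overline{\alpha}}$ and $d\cdot\overline{x}=\overline{x\cdot d^*}$ for $\alpha\in\mathsf{C}$, $d\in\mathcal{D}$. Then $\mathcal{E}=\overline{\mathcal{H}}\otimes_{\mathsf{C}}\mathcal{H}$ is a $(\mathcal{D},\mathcal{D})$-bimodule with $d\cdot(\overline{x}\otimes y)\cdot d'=(d\cdot\overline{x})\otimes(y\cdot d')$. The map $I:\mathcal{E}\to\mathcal{E}$ is the $\mathsf{C}$-antilinear involution determined by $I(\overline{x}\otimes y)=\overline{y}\otimes x$; it satisfies $I(d\cdot z\cdot d')=d'^*\cdot I(z)\cdot d^*$. A $(\mathcal{D},\mathcal{D})$-bimodule map is a $\mathsf{C}$-linear map commuting with the left and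 right $\mathcal{D}$-actions. **Completely positive maps.** $M_n(\mathcal{E})$ denotes the $n\times n$ matrices with entries in $\mathcal{E}$. Let $\mathcal{K}_n(\mathcal{E})\subseteq M_n(\mathcal{E})$ be the set of convex combinations (finite sums with coefficients $\alpha>0$ in $\mathsf{R}$) of elements $z=(z_{ij})$ of the form $z_{ij}=\overline{x_i}\otimes x_j$ with $x_1,\dots,x_n\in\mathcal{H}$. A $(\mathcal{D},\mathcal{D})$-bimodule map $\Phi:\mathcal{E}\to\mathcal{D}$ with $\Phi(z)^*=\Phi(I(z))$ for all $z\in\mathcal{E}$ is called completely positive if $\Phi(\mathcal{K}_n(\mathcal{E}))\subseteq M_n(\mathcal{D})^+$ for all $n\in\mathbb{N}$, where $\Phi$ is applied to matrices entrywise. *)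

theory Defs
  imports
    "HOL-Library.FuncSet"
    "HOL-Library.Poly_Mapping"
    "Jordan_Normal_Form.Matrix"
begin

section \<open>The ring obtained by adjoining a square root of -1\<close>

text \<open>An ordered ring is a type of sort \<open>{comm_ring_1, linordered_ring}\<close>: a commutative unital
  ring with a total order that is invariant under translations and under multiplication by
  nonnegative elements. Zero divisors are not excluded, so integral domains (class
  \<open>linordered_idom\<close>) are a special case.\<close>

datatype 'r adjoin_i = Adj (re: 'r) (im: 'r)

instantiation adjoin_i :: (comm_ring_1) comm_ring_1
begin

definition "0 = Adj 0 0"
definition "1 = Adj 1 0"
definition "a + b = Adj (re a + re b) (im a + im b)"
definition "a - b = Adj (re a - re b) (im a - im b)"
definition "- a = Adj (- re a) (- im a)"
definition "a * b = Adj (re a * re b - im a * im b) (re a * im b + im a * re b)"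

instance
  by standard
    (simp_all add: zero_adjoin_i_def one_adjoin_i_def plus_adjoin_i_def minus_adjoin_i_def
      uminus_adjoin_i_def times_adjoin_i_def algebra_simps)

end

definition adj_conj :: "'r::comm_ring_1 adjoin_i \<Rightarrow> 'r adjoin_i" where
  "adj_conj a = Adj (re a) (- im a)"

definition adj_of :: "'r::comm_ring_1 \<Rightarrow> 'r adjoin_i" where
  "adj_of r = Adj r 0"

definition adj_nonneg :: "'r::{comm_ring_1, linordered_ring} adjoin_i \<Rightarrow> bool" where
  "adj_nonneg a \<longleftrightarrow> im a = 0 \<and> 0 \<le> re a"

lemma adj_conj_simps [simp]:
  "adj_conj (a + b) = adj_conj a + adj_conj b"
  "adj_conj (a - b) = adj_conj a - adj_conj b"
  "adj_conj (a * b) = adj_conj a * adj_conj b"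
  "adj_conj 0 = 0" "adj_conj 1 = 1" "adj_conj (adj_conj a) = a"
  by (simp_all add: adj_conj_def zero_adjoin_i_def one_adjoin_i_def plus_adjoin_i_def
      minus_adjoin_i_def times_adjoin_i_def algebra_simps)

section \<open>Star-algebras and modules over them\<close>

text \<open>The type class \<open>ring\<close> does not require a unit.\<close>

locale star_algebra = Modules.module scale
  for scale :: "'r::{comm_ring_1, linordered_ring} adjoin_i \<Rightarrow> 'd::ring \<Rightarrow> 'd" +
  fixes star :: "'d \<Rightarrow> 'd"
  assumes scale_mult_left: "scale \<alpha> (a * b) = scale \<alpha> a * b"
    and scale_mult_right: "scale \<alpha> (a * b) = a * scale \<alpha> b"
    and star_add: "star (a + b) = star a + star b"
    and star_scale: "star (scale \<alpha> a) = scale (adj_conj \<alpha>) (star a)"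
    and star_mult: "star (a * b) = star b * star a"
    and star_star: "star (star a) = a"

locale right_star_module = D: star_algebra sD star + H: Modules.module sH
  for sD :: "'r::{comm_ring_1, linordered_ring} adjoin_i \<Rightarrow> 'd::ring \<Rightarrow> 'd"
    and star :: "'d \<Rightarrow> 'd"
    and sH :: "'r adjoin_i \<Rightarrow> 'h::ab_group_add \<Rightarrow> 'h" +
  fixes act :: "'h \<Rightarrow> 'd \<Rightarrow> 'h"
  assumes act_add_left: "act (x + y) d = act x d + act y d"
    and act_add_right: "act x (d + d') = act x d + act x d'"
    and act_act: "act (act x d) d' = act x (d * d')"
    and act_scale_left: "act (sH \<alpha> x) d = sH \<alpha> (act x d)"
    and act_scale_right: "act x (sD \<alpha> d) = sH \<alpha> (act x d)"
    and act_unit: "(\<And>d. e * d = d \<and> d * e = d) \<Longrightarrow> act x e = x"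

section \<open>Positive elements\<close>

text \<open>A star-algebra is given here by a carrier set and its operations, so that the definition
  applies to matrices whose size is a variable.\<close>

definition positive_functional ::
  "'a set \<Rightarrow> ('a \<Rightarrow> 'a \<Rightarrow> 'a) \<Rightarrow> ('r::{comm_ring_1, linordered_ring} adjoin_i \<Rightarrow> 'a \<Rightarrow> 'a) \<Rightarrow>
    ('a \<Rightarrow> 'a \<Rightarrow> 'a) \<Rightarrow> ('a \<Rightarrow> 'a) \<Rightarrow> ('a \<Rightarrow> 'r adjoin_i) \<Rightarrow> bool" where
  "positive_functional A pls scale tms star \<omega> \<longleftrightarrow>
     (\<forall>a\<in>A. \<forall>b\<in>A. \<omega> (pls a b) = \<omega> a + \<omega> b) \<and>
     (\<forall>\<alpha>. \<forall>a\<in>A. \<omega> (scale \<alpha> a) = \<alpha> * \<omega> a) \<and>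
     (\<forall>a\<in>A. adj_nonneg (\<omega> (tms (star a) a)))"

definition positive_elements ::
  "'a set \<Rightarrow> ('a \<Rightarrow> 'a \<Rightarrow> 'a) \<Rightarrow> ('r::{comm_ring_1, linordered_ring} adjoin_i \<Rightarrow> 'a \<Rightarrow> 'a) \<Rightarrow>
    ('a \<Rightarrow> 'a \<Rightarrow> 'a) \<Rightarrow> ('a \<Rightarrow> 'a) \<Rightarrow> 'a set" where
  "positive_elements A pls scale tms star =
     {a \<in> A. \<forall>\<omega>. positive_functional A pls scale tms star \<omega> \<longrightarrow> adj_nonneg (\<omega> a)}"

definition positive_matrices ::
  "('r::{comm_ring_1, linordered_ring} adjoin_i \<Rightarrow> 'd::ring \<Rightarrow> 'd) \<Rightarrow> ('d \<Rightarrow> 'd) \<Rightarrow> nat \<Rightarrow>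
    'd mat set" where
  "positive_matrices sD star n =
     positive_elements (carrier_mat n n) (+) (\<lambda>\<alpha>. map_mat (sD \<alpha>)) (*)
       (\<lambda>M. map_mat star (transpose_mat M))"

section \<open>Inner products\<close>

definition inner_products ::
  "('r::{comm_ring_1, linordered_ring} adjoin_i \<Rightarrow> 'd::ring \<Rightarrow> 'd) \<Rightarrow> ('d \<Rightarrow> 'd) \<Rightarrow>
    ('r adjoin_i \<Rightarrow> 'h::ab_group_add \<Rightarrow> 'h) \<Rightarrow> ('h \<Rightarrow> 'd \<Rightarrow> 'h) \<Rightarrow> ('h \<Rightarrow> 'h \<Rightarrow> 'd) set" where
  "inner_products sD star sH act = {ip.
     (\<forall>x y y'. ip x (y + y') = ip x y + ip x y') \<and>
     (\<forall>x x' y. ip (x + x') y = ip x y + ip x' y) \<and>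
     (\<forall>\<alpha> x y. ip x (sH \<alpha> y) = sD \<alpha> (ip x y)) \<and>
     (\<forall>\<alpha> x y. ip (sH \<alpha> x) y = sD (adj_conj \<alpha>) (ip x y)) \<and>
     (\<forall>x y. ip x y = star (ip y x)) \<and>
     (\<forall>x y d. ip x (act y d) = ip x y * d)}"

definition completely_positive_ip ::
  "('r::{comm_ring_1, linordered_ring} adjoin_i \<Rightarrow> 'd::ring \<Rightarrow> 'd) \<Rightarrow> ('d \<Rightarrow> 'd) \<Rightarrow>
    ('h \<Rightarrow> 'h \<Rightarrow> 'd) \<Rightarrow> bool" where
  "completely_positive_ip sD star ip \<longleftrightarrow>
     (\<forall>n. \<forall>x :: nat \<Rightarrow> 'h. mat n n (\<lambda>(i, j). ip (x i) (x j)) \<in> positive_matrices sD star n)"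

section \<open>Tensor products\<close>

text \<open>The tensor product of two modules over a commutative ring \<open>'c\<close> is the free module on pairs,
  i.e. the finitely supported functions \<open>'a \<times> 'b \<Rightarrow>\<^sub>0 'c\<close>, modulo the submodule spanned by the
  bilinearity relations. Its elements are the cosets, so operations of the free module
  are transferred along representatives.\<close>

definition free_scale :: "'c::comm_ring_1 \<Rightarrow> ('x \<Rightarrow>\<^sub>0 'c) \<Rightarrow> 'x \<Rightarrow>\<^sub>0 'c" where
  "free_scale c = Poly_Mapping.map ((*) c)"

definition tensor_relators ::
  "('c::comm_ring_1 \<Rightarrow> 'a::ab_group_add \<Rightarrow> 'a) \<Rightarrow> ('c \<Rightarrow> 'b::ab_group_add \<Rightarrow> 'b) \<Rightarrow>
    ('a \<times> 'b \<Rightarrow>\<^sub>0 'c) set" where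
  "tensor_relators s1 s2 =
     {Poly_Mapping.single (a + a', b) 1 - Poly_Mapping.single (a, b) 1
        - Poly_Mapping.single (a', b) 1 | a a' b. True} \<union>
     {Poly_Mapping.single (a, b + b') 1 - Poly_Mapping.single (a, b) 1
        - Poly_Mapping.single (a, b') 1 | a b b'. True} \<union>
     {Poly_Mapping.single (s1 c a, b) 1 - Poly_Mapping.single (a, b) c | c a b. True} \<union>
     {Poly_Mapping.single (a, s2 c b) 1 - Poly_Mapping.single (a, b) c | c a b. True}"

definition tensor_eq ::
  "('c::comm_ring_1 \<Rightarrow> 'a::ab_group_add \<Rightarrow> 'a) \<Rightarrow> ('c \<Rightarrow> 'b::ab_group_add \<Rightarrow> 'b) \<Rightarrow>
    (('a \<times> 'b \<Rightarrow>\<^sub>0 'c) \<times> ('a \<times> 'b \<Rightarrow>\<^sub>0 'c)) set" where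
  "tensor_eq s1 s2 =
     {(f, g). f - g \<in> Modules.module.span free_scale (tensor_relators s1 s2)}"

section \<open>The bimodule\<close>

text \<open>The complex conjugate of \<open>'h\<close> is the same additive group with scalar multiplication
  \<open>conj_scale sH\<close> and left action \<open>conj_act star act\<close>; the map sending \<open>x\<close> to its conjugate is
  the identity.\<close>

definition conj_scale ::
  "('r::comm_ring_1 adjoin_i \<Rightarrow> 'h \<Rightarrow> 'h) \<Rightarrow> 'r adjoin_i \<Rightarrow> 'h \<Rightarrow> 'h" where
  "conj_scale sH \<alpha> x = sH (adj_conj \<alpha>) x"

definition conj_act :: "('d \<Rightarrow> 'd) \<Rightarrow> ('h \<Rightarrow> 'd \<Rightarrow> 'h) \<Rightarrow> 'd \<Rightarrow> 'h \<Rightarrow> 'h" where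
  "conj_act star act d x = act x (star d)"

type_synonym ('r, 'h) free_hh = "'h \<times> 'h \<Rightarrow>\<^sub>0 'r adjoin_i"
type_synonym ('r, 'h) scaling = "'r adjoin_i \<Rightarrow> 'h \<Rightarrow> 'h"

definition E_class ::
  "('r::comm_ring_1, 'h::ab_group_add) scaling \<Rightarrow> ('r, 'h) free_hh \<Rightarrow> ('r, 'h) free_hh set" where
  "E_class sH f = tensor_eq (conj_scale sH) sH `` {f}"

definition E_space ::
  "('r::comm_ring_1, 'h::ab_group_add) scaling \<Rightarrow> ('r, 'h) free_hh set set" where
  "E_space sH = UNIV // tensor_eq (conj_scale sH) sH"

definition E_tensor ::
  "('r::comm_ring_1, 'h::ab_group_add) scaling \<Rightarrow> 'h \<Rightarrow> 'h \<Rightarrow> ('r, 'h) free_hh set" where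
  "E_tensor sH x y = E_class sH (Poly_Mapping.single (x, y) 1)"

definition E_lift ::
  "('r::comm_ring_1, 'h::ab_group_add) scaling \<Rightarrow> (('r, 'h) free_hh \<Rightarrow> ('r, 'h) free_hh) \<Rightarrow>
    ('r, 'h) free_hh set \<Rightarrow> ('r, 'h) free_hh set" where
  "E_lift sH h z = (\<Union>f\<in>z. E_class sH (h f))"

definition E_zero ::
  "('r::comm_ring_1, 'h::ab_group_add) scaling \<Rightarrow> ('r, 'h) free_hh set" where
  "E_zero sH = E_class sH 0"

definition E_add ::
  "('r::comm_ring_1, 'h::ab_group_add) scaling \<Rightarrow>
    ('r, 'h) free_hh set \<Rightarrow> ('r, 'h) free_hh set \<Rightarrow> ('r, 'h) free_hh set" where
  "E_add sH z w = (\<Union>f\<in>z. \<Union>g\<in>w. E_class sH (f + g))"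

definition E_scale ::
  "('r::comm_ring_1, 'h::ab_group_add) scaling \<Rightarrow> 'r adjoin_i \<Rightarrow>
    ('r, 'h) free_hh set \<Rightarrow> ('r, 'h) free_hh set" where
  "E_scale sH \<alpha> = E_lift sH (free_scale \<alpha>)"

text \<open>\<open>free_push p t\<close> is the additive extension of
  \<open>single k c \<mapsto> single (p k) (t c)\<close>, for additive \<open>t\<close>.\<close>

definition free_push :: "('x \<Rightarrow> 'y) \<Rightarrow> ('c \<Rightarrow> 'c) \<Rightarrow> ('x \<Rightarrow>\<^sub>0 'c::comm_ring_1) \<Rightarrow> ('y \<Rightarrow>\<^sub>0 'c)" where
  "free_push p t f =
     (\<Sum>k\<in>Poly_Mapping.keys f. Poly_Mapping.single (p k) (t (Poly_Mapping.lookup f k)))"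

definition E_left ::
  "('d \<Rightarrow> 'd) \<Rightarrow> ('r::comm_ring_1, 'h::ab_group_add) scaling \<Rightarrow> ('h \<Rightarrow> 'd \<Rightarrow> 'h) \<Rightarrow> 'd \<Rightarrow>
    ('r, 'h) free_hh set \<Rightarrow> ('r, 'h) free_hh set" where
  "E_left star sH act d = E_lift sH (free_push (\<lambda>(x, y). (conj_act star act d x, y)) id)"

definition E_right ::
  "('r::comm_ring_1, 'h::ab_group_add) scaling \<Rightarrow> ('h \<Rightarrow> 'd \<Rightarrow> 'h) \<Rightarrow>
    ('r, 'h) free_hh set \<Rightarrow> 'd \<Rightarrow> ('r, 'h) free_hh set" where
  "E_right sH act z d = E_lift sH (free_push (\<lambda>(x, y). (x, act y d)) id) z"

definition E_inv ::
  "('r::comm_ring_1, 'h::ab_group_add) scaling \<Rightarrow>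
    ('r, 'h) free_hh set \<Rightarrow> ('r, 'h) free_hh set" where
  "E_inv sH = E_lift sH (free_push (\<lambda>(x, y). (y, x)) adj_conj)"

text \<open>\<open>E_sum sH m z\<close> is the sum of \<open>z 0, \<dots>, z (m - 1)\<close>.\<close>

primrec E_sum ::
  "('r::comm_ring_1, 'h::ab_group_add) scaling \<Rightarrow> nat \<Rightarrow> (nat \<Rightarrow> ('r, 'h) free_hh set) \<Rightarrow>
    ('r, 'h) free_hh set" where
  "E_sum sH 0 z = E_zero sH"
| "E_sum sH (Suc m) z = E_add sH (E_sum sH m z) (z m)"

section \<open>Bimodule maps\<close>

text \<open>A map on the bimodule is a function on the set \<open>E_space sH\<close>; it is made unique by fixing
  its value off that set (\<open>extensional\<close>).\<close>

definition hermitian_bimodule_maps ::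
  "('r::{comm_ring_1, linordered_ring} adjoin_i \<Rightarrow> 'd::ring \<Rightarrow> 'd) \<Rightarrow> ('d \<Rightarrow> 'd) \<Rightarrow>
    ('r, 'h::ab_group_add) scaling \<Rightarrow> ('h \<Rightarrow> 'd \<Rightarrow> 'h) \<Rightarrow>
    (('r, 'h) free_hh set \<Rightarrow> 'd) set" where
  "hermitian_bimodule_maps sD star sH act = {\<Phi> \<in> extensional (E_space sH).
     (\<forall>z\<in>E_space sH. \<forall>w\<in>E_space sH. \<Phi> (E_add sH z w) = \<Phi> z + \<Phi> w) \<and>
     (\<forall>\<alpha>. \<forall>z\<in>E_space sH. \<Phi> (E_scale sH \<alpha> z) = sD \<alpha> (\<Phi> z)) \<and>
     (\<forall>d. \<forall>z\<in>E_space sH. \<Phi> (E_left star sH act d z) = d * \<Phi> z) \<and>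
     (\<forall>d. \<forall>z\<in>E_space sH. \<Phi> (E_right sH act z d) = \<Phi> z * d) \<and>
     (\<forall>z\<in>E_space sH. star (\<Phi> z) = \<Phi> (E_inv sH z))}"

definition convex_K ::
  "('r::{comm_ring_1, linordered_ring}, 'h::ab_group_add) scaling \<Rightarrow> nat \<Rightarrow>
    ('r, 'h) free_hh set mat set" where
  "convex_K sH n =
     {mat n n (\<lambda>(i, j). E_sum sH m (\<lambda>k. E_scale sH (adj_of (\<alpha> k)) (E_tensor sH (x k i) (x k j))))
      | (m :: nat) (\<alpha> :: nat \<Rightarrow> 'r) (x :: nat \<Rightarrow> nat \<Rightarrow> 'h). \<forall>k<m. 0 < \<alpha> k}"

definition completely_positive_map ::
  "('r::{comm_ring_1, linordered_ring} adjoin_i \<Rightarrow> 'd::ring \<Rightarrow> 'd) \<Rightarrow> ('d \<Rightarrow> 'd) \<Rightarrow>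
    ('r, 'h::ab_group_add) scaling \<Rightarrow> (('r, 'h) free_hh set \<Rightarrow> 'd) \<Rightarrow> bool" where
  "completely_positive_map sD star sH \<Phi> \<longleftrightarrow>
     (\<forall>n. map_mat \<Phi> ` convex_K sH n \<subseteq> positive_matrices sD star n)"

end

theory Submission
  imports Defs
begin

text \<open>The bijection is the universal property of the tensor product, read through the conjugate
  module. A map on \<open>\<H> \<times> \<H>\<close> that is antilinear in the first and linear in the second argument
  is a bilinear map on \<open>conj \<H> \<times> \<H>\<close>, hence factors uniquely through \<open>\<E>\<close>; under this correspondence the right
  linearity of an inner product is the right linearity of the bimodule map, its hermitian symmetry
  is compatibility with the involution, and the left linearity follows from these two because
  \<open>\<langle>x \<cdot> d\<^sup>*, y\<rangle> = \<langle>y, x \<cdot> d\<^sup>*\<rangle>\<^sup>* = d \<langle>x, y\<rangle>\<close>.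

  Elements of \<open>\<E>\<close> are cosets of formal combinations of pairs. Everything about such a coset is
  computed on a representative, which is legitimate because a semilinear map of free modules that
  sends the bilinearity relators into a submodule sends their whole span into it
  (\<open>span_into_subspace\<close>). Two additive maps out of a free module agree once they agree on the
  one-term combinations \<open>single k c\<close> (\<open>additive_free_eqI\<close>), so each of the identities required
  of a bimodule map reduces to elementary tensors.

  For complete positivity, an elementary generator of the cone \<open>\<K>\<^sub>n\<close> is mapped by \<open>\<Phi>\<close> to the
  Gram matrix \<open>(\<langle>x\<^sub>i, x\<^sub>j\<rangle>)\<close>. Such a generator lies in \<open>\<K>\<^sub>n\<close> with coefficient 1, which gives one
  direction; the other holds because the positive elements of a star-algebra form a convex
  cone (\<open>positive_matrices_add\<close>, \<open>positive_matrices_scale\<close>).\<close>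

section \<open>Additive maps on free modules\<close>

lemma lookup_free_scale [simp]:
  "Poly_Mapping.lookup (free_scale c f) k = c * Poly_Mapping.lookup f k"
  by (simp add: free_scale_def Poly_Mapping.map.rep_eq when_def)

interpretation free: Modules.module free_scale
  by standard (auto intro!: poly_mapping_eqI simp: lookup_add algebra_simps)

lemma free_scale_single [simp]:
  "free_scale c (Poly_Mapping.single k d) = Poly_Mapping.single k (c * d)"
  by (rule poly_mapping_eqI) (simp add: lookup_single when_def)

definition free_extend ::
  "('x \<Rightarrow> 'c::ab_group_add \<Rightarrow> 'm::ab_group_add) \<Rightarrow> ('x \<Rightarrow>\<^sub>0 'c) \<Rightarrow> 'm" where
  "free_extend g f = (\<Sum>k\<in>Poly_Mapping.keys f. g k (Poly_Mapping.lookup f k))"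

lemma additive_free_extend:
  assumes "\<And>k. additive (g k)"
  shows "additive (free_extend g)"
  unfolding free_extend_def
  using assms by unfold_locales (auto intro!: setsum_keys_plus_distrib
      simp: additive.zero additive.add)

lemma free_extend_single [simp]:
  assumes "\<And>k. additive (g k)"
  shows "free_extend g (Poly_Mapping.single k c) = g k c"
  using additive.zero[OF assms] by (simp add: free_extend_def)

lemma free_push_eq: "free_push p t = free_extend (\<lambda>k c. Poly_Mapping.single (p k) (t c))"
  by (simp add: fun_eq_iff free_push_def free_extend_def)

lemma additive_single: "additive t \<Longrightarrow> additive (\<lambda>c. Poly_Mapping.single k (t c))"
  by (simp add: additive_def single_add)

lemma additive_free_push: "additive t \<Longrightarrow> additive (free_push p t)"
  unfolding free_push_eq by (intro additive_free_extend additive_single)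

lemma free_push_single [simp]:
  "additive t \<Longrightarrow>
    free_push p t (Poly_Mapping.single k c) = Poly_Mapping.single (p k) (t c)"
  unfolding free_push_eq by (simp add: additive_single)

lemma additive_free_eqI:
  fixes F G :: "('x \<Rightarrow>\<^sub>0 'c::ab_group_add) \<Rightarrow> 'm::ab_group_add"
  assumes F: "additive F" and G: "additive G"
    and eq: "\<And>k c. F (Poly_Mapping.single k c) = G (Poly_Mapping.single k c)"
  shows "F f = G f"
proof (induction f rule: update_induct)
  case const
  show ?case using F G by (simp add: additive.zero)
next
  case (update f k c)
  have "Poly_Mapping.update k c f = f + Poly_Mapping.single k c"
    using update(1)
    by (intro poly_mapping_eqI)
      (auto simp: lookup_update lookup_add lookup_single when_def in_keys_iff)
  then show ?case
    using F G eq update by (simp add: additive.add)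
qed

text \<open>The twist \<open>t\<close> is needed for the involution of \<open>\<E>\<close>, which is conjugate linear.\<close>

lemma span_into_subspace:
  fixes F :: "('x \<Rightarrow>\<^sub>0 'c::comm_ring_1) \<Rightarrow> 'm::ab_group_add"
  assumes M: "Modules.module s" and F: "additive F"
    and t: "\<And>c k d. F (Poly_Mapping.single k (c * d)) = s (t c) (F (Poly_Mapping.single k d))"
    and T: "Modules.module.subspace s T" and S: "\<And>u. u \<in> S \<Longrightarrow> F u \<in> T"
    and f: "f \<in> free.span S"
  shows "F f \<in> T"
proof -
  interpret M: Modules.module s by (fact M)
  interpret F: additive F by (fact F)
  have scale: "F (free_scale c u) = s (t c) (F u)" for c u
    by (rule additive_free_eqI[where F = "\<lambda>u. F (free_scale c u)"])
      (auto simp: additive_def F.add free.scale_right_distrib M.scale_right_distrib t)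
  show ?thesis
    using f
  proof (induction rule: free.span_induct_alt)
    case base
    show ?case using M.subspace_0[OF T] by (simp add: F.zero)
  next
    case (step c x y)
    then show ?case
      using T S by (simp add: F.add scale M.subspace_add M.subspace_scale)
  qed
qed

section \<open>Operations on the tensor product\<close>

lemma tensor_relators_intros:
  "a'' = a + a' \<Longrightarrow> Poly_Mapping.single (a'', b) 1 - Poly_Mapping.single (a, b) 1
    - Poly_Mapping.single (a', b) 1 \<in> tensor_relators s1 s2"
  "b'' = b + b' \<Longrightarrow> Poly_Mapping.single (a, b'') 1 - Poly_Mapping.single (a, b) 1
    - Poly_Mapping.single (a, b') 1 \<in> tensor_relators s1 s2"
  "a' = s1 c a \<Longrightarrow>
    Poly_Mapping.single (a', b) 1 - Poly_Mapping.single (a, b) c \<in> tensor_relators s1 s2"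
  "b' = s2 c b \<Longrightarrow>
    Poly_Mapping.single (a, b') 1 - Poly_Mapping.single (a, b) c \<in> tensor_relators s1 s2"
  unfolding tensor_relators_def by blast+

lemma tensor_relators_cases [consumes 1, case_names add_left add_right scale_left scale_right]:
  assumes "u \<in> tensor_relators s1 s2"
  obtains a a' b where "u = Poly_Mapping.single (a + a', b) 1 - Poly_Mapping.single (a, b) 1
      - Poly_Mapping.single (a', b) 1"
  | a b b' where "u = Poly_Mapping.single (a, b + b') 1 - Poly_Mapping.single (a, b) 1
      - Poly_Mapping.single (a, b') 1"
  | c a b where "u = Poly_Mapping.single (s1 c a, b) 1 - Poly_Mapping.single (a, b) c"
  | c a b where "u = Poly_Mapping.single (a, s2 c b) 1 - Poly_Mapping.single (a, b) c"
  using assms unfolding tensor_relators_def by blast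

abbreviation E_relations ::
  "('r::comm_ring_1, 'h::ab_group_add) scaling \<Rightarrow> ('r, 'h) free_hh set" where
  "E_relations sH \<equiv> free.span (tensor_relators (conj_scale sH) sH)"

lemma E_class_iff: "g \<in> E_class sH f \<longleftrightarrow> f - g \<in> E_relations sH"
  by (simp add: E_class_def tensor_eq_def)

lemma E_class_self [simp]: "f \<in> E_class sH f"
  by (simp add: E_class_iff free.span_zero)

lemma E_class_eqI:
  assumes "f - g \<in> E_relations sH"
  shows "E_class sH f = E_class sH g"
proof -
  have "g - f \<in> E_relations sH"
    using free.span_neg[OF assms] by simp
  then show ?thesis
    using assms free.span_add[of "f - g" _ "g - _"] free.span_add[of "g - f" _ "f - _"]
    by (auto simp: E_class_iff)
qed

lemma E_class_in_space [simp]: "E_class sH f \<in> E_space sH"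
  by (auto simp: E_space_def E_class_def quotient_def)

lemma E_space_cases:
  assumes "z \<in> E_space sH"
  obtains f where "z = E_class sH f"
  using assms by (auto simp: E_space_def E_class_def quotient_def)

lemma E_add_class [simp]:
  "E_add sH (E_class sH f) (E_class sH g) = E_class sH (f + g)"
proof -
  have "E_class sH (f' + g') = E_class sH (f + g)"
    if "f' \<in> E_class sH f" "g' \<in> E_class sH g" for f' g'
  proof (rule E_class_eqI[symmetric])
    have "(f - f') + (g - g') \<in> E_relations sH"
      using that by (intro free.span_add) (simp_all add: E_class_iff)
    then show "(f + g) - (f' + g') \<in> E_relations sH"
      by (simp add: algebra_simps)
  qed
  then have "E_add sH (E_class sH f) (E_class sH g) =
      (\<Union>f'\<in>E_class sH f. \<Union>g'\<in>E_class sH g. E_class sH (f + g))"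
    unfolding E_add_def by (intro SUP_cong refl)
  then show ?thesis
    using E_class_self by blast
qed

text \<open>When \<open>h\<close> preserves the relations, all sets in the union defining \<open>E_lift\<close> are the same
  coset.\<close>

lemma E_lift_class:
  assumes h: "additive h" and R: "\<And>u. u \<in> E_relations sH \<Longrightarrow> h u \<in> E_relations sH"
  shows "E_lift sH h (E_class sH f) = E_class sH (h f)"
proof -
  have "E_class sH (h f') = E_class sH (h f)" if "f' \<in> E_class sH f" for f'
    using R[of "f - f'"] that
    by (intro E_class_eqI[symmetric]) (simp add: E_class_iff additive.diff[OF h])
  then have "E_lift sH h (E_class sH f) = (\<Union>f'\<in>E_class sH f. E_class sH (h f))"
    unfolding E_lift_def by (intro SUP_cong refl)
  then show ?thesis
    using E_class_self by blast
qed

lemma E_scale_class [simp]: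
  "E_scale sH c (E_class sH f) = E_class sH (free_scale c f)"
  unfolding E_scale_def
  by (rule E_lift_class) (simp_all add: additive_def free.scale_right_distrib free.span_scale)

text \<open>Serves the two module actions and the involution at once: the former have \<open>t = id\<close>, the latter
  \<open>t = adj_conj\<close>. Multiplicativity of \<open>t\<close> makes the pushforward semilinear, so that checking
  the relators suffices.\<close>

lemma E_lift_push_class:
  fixes sH :: "('r::comm_ring_1, 'h::ab_group_add) scaling"
  assumes t: "additive t" "\<And>c d. t (c * d) = t c * t d"
    and R: "\<And>u. u \<in> tensor_relators (conj_scale sH) sH \<Longrightarrow>
      free_push p t u \<in> tensor_relators (conj_scale sH) sH"
  shows "E_lift sH (free_push p t) (E_class sH f) = E_class sH (free_push p t f)"
proof (rule E_lift_class)
  show "additive (free_push p t)"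
    using t(1) by (rule additive_free_push)
  show "free_push p t u \<in> E_relations sH" if "u \<in> E_relations sH" for u
    using that
    by (rule span_into_subspace[where s = free_scale and t = t, rotated -1])
      (auto simp: t free.module_axioms additive_free_push free.span_base R)
qed

context right_star_module
begin

lemma E_left_class:
  "E_left star sH act d (E_class sH f) =
    E_class sH (free_push (\<lambda>(x, y). (conj_act star act d x, y)) id f)"
  unfolding E_left_def
proof (rule E_lift_push_class)
  have id: "additive (id :: 'r adjoin_i \<Rightarrow> _)"
    by (simp add: additive_def)
  fix u assume "u \<in> tensor_relators (conj_scale sH) sH"
  then show "free_push (\<lambda>(x, y). (conj_act star act d x, y)) id u
      \<in> tensor_relators (conj_scale sH) sH"
    by (cases rule: tensor_relators_cases)
      (simp_all add: additive.diff[OF additive_free_push[OF id]] id conj_act_def conj_scale_def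
        act_add_left act_scale_left tensor_relators_intros)
qed (simp_all add: additive_def)

lemma E_right_class:
  "E_right sH act (E_class sH f) d =
    E_class sH (free_push (\<lambda>(x, y). (x, act y d)) id f)"
  unfolding E_right_def
proof (rule E_lift_push_class)
  have id: "additive (id :: 'r adjoin_i \<Rightarrow> _)"
    by (simp add: additive_def)
  fix u assume "u \<in> tensor_relators (conj_scale sH) sH"
  then show "free_push (\<lambda>(x, y). (x, act y d)) id u
      \<in> tensor_relators (conj_scale sH) sH"
    by (cases rule: tensor_relators_cases)
      (simp_all add: additive.diff[OF additive_free_push[OF id]] id act_add_left act_scale_left
        tensor_relators_intros)
qed (simp_all add: additive_def)

end

lemma E_inv_class:
  fixes sH :: "('r::comm_ring_1, 'h::ab_group_add) scaling"
  shows "E_inv sH (E_class sH f) = E_class sH (free_push (\<lambda>(x, y). (y, x)) adj_conj f)"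
  unfolding E_inv_def
proof (rule E_lift_push_class)
  have conj: "additive (adj_conj :: 'r adjoin_i \<Rightarrow> _)"
    by (simp add: additive_def)
  fix u assume "u \<in> tensor_relators (conj_scale sH) sH"
  \<comment> \<open>The swap exchanges the two additivity relators with each other, and likewise the two
    scaling relators, with \<open>c\<close> replaced by its conjugate.\<close>
  then show "free_push (\<lambda>(x, y). (y, x)) adj_conj u \<in> tensor_relators (conj_scale sH) sH"
    by (cases rule: tensor_relators_cases)
      (simp_all add: additive.diff[OF additive_free_push[OF conj]] conj conj_scale_def
        tensor_relators_intros)
qed (simp_all add: additive_def)

section \<open>The cone of positive matrices\<close>

lemma adj_nonneg_add: "adj_nonneg a \<Longrightarrow> adj_nonneg b \<Longrightarrow> adj_nonneg (a + b)"
  by (simp add: adj_nonneg_def plus_adjoin_i_def)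

lemma adj_nonneg_scale: "0 \<le> r \<Longrightarrow> adj_nonneg a \<Longrightarrow> adj_nonneg (adj_of r * a)"
  by (simp add: adj_nonneg_def adj_of_def times_adjoin_i_def)

lemma positive_matrices_add:
  assumes "A \<in> positive_matrices sD star n" "B \<in> positive_matrices sD star n"
  shows "A + B \<in> positive_matrices sD star n"
  using assms
  by (auto simp: positive_matrices_def positive_elements_def positive_functional_def
      intro!: adj_nonneg_add)

lemma positive_matrices_scale:
  assumes "0 \<le> r" "A \<in> positive_matrices sD star n"
  shows "map_mat (sD (adj_of r)) A \<in> positive_matrices sD star n"
  using assms
  by (auto simp: positive_matrices_def positive_elements_def positive_functional_def
      intro!: adj_nonneg_scale)

text \<open>The zero matrix enters through the empty combination, which belongs to the cone
  \<open>\<K>\<^sub>n\<close>.\<close>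

lemma (in star_algebra) positive_matrices_zero:
  "0\<^sub>m n n \<in> positive_matrices scale star n"
proof -
  have "map_mat (scale 0) (0\<^sub>m n n :: 'd mat) = 0\<^sub>m n n"
    by (rule eq_matI) simp_all
  moreover have "adj_nonneg (0 :: 'r adjoin_i)"
    by (simp add: adj_nonneg_def zero_adjoin_i_def)
  ultimately have "adj_nonneg (\<omega> (0\<^sub>m n n))"
    if "\<forall>\<alpha>. \<forall>a\<in>carrier_mat n n. \<omega> (map_mat (scale \<alpha>) a) = \<alpha> * \<omega> a"
    for \<omega> :: "'d mat \<Rightarrow> 'r adjoin_i"
    using that[rule_format, of "0\<^sub>m n n" 0] by simp
  then show ?thesis
    unfolding positive_matrices_def positive_elements_def positive_functional_def
    by (intro CollectI conjI allI impI zero_carrier_mat) blast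
qed

section \<open>From bimodule maps to inner products\<close>

lemma E_class_single:
  "E_class sH (Poly_Mapping.single (x, y) c) = E_scale sH c (E_tensor sH x y)"
  by (simp add: E_tensor_def)

lemma E_tensor_add_left:
  "E_tensor sH (x + x') y = E_add sH (E_tensor sH x y) (E_tensor sH x' y)"
  unfolding E_tensor_def E_add_class
  by (intro E_class_eqI free.span_base)
    (simp add: tensor_relators_intros flip: diff_diff_eq)

lemma E_tensor_add_right:
  "E_tensor sH x (y + y') = E_add sH (E_tensor sH x y) (E_tensor sH x y')"
  unfolding E_tensor_def E_add_class
  by (intro E_class_eqI free.span_base)
    (simp add: tensor_relators_intros flip: diff_diff_eq)

lemma E_tensor_scale_left:
  "E_tensor sH (sH c x) y = E_scale sH (adj_conj c) (E_tensor sH x y)"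
  unfolding E_tensor_def E_scale_class free_scale_single mult_1_right
  by (intro E_class_eqI free.span_base tensor_relators_intros(3)) (simp add: conj_scale_def)

lemma E_tensor_scale_right:
  "E_tensor sH x (sH c y) = E_scale sH c (E_tensor sH x y)"
  unfolding E_tensor_def E_scale_class free_scale_single mult_1_right
  by (intro E_class_eqI free.span_base tensor_relators_intros(4)) (rule refl)

lemma E_tensor_in_space [simp]: "E_tensor sH x y \<in> E_space sH"
  by (simp add: E_tensor_def)

lemma E_inv_tensor: "E_inv sH (E_tensor sH x y) = E_tensor sH y x"
  by (simp add: E_tensor_def E_inv_class additive_def)

context right_star_module
begin

lemma E_right_tensor: "E_right sH act (E_tensor sH x y) d = E_tensor sH x (act y d)"
  by (simp add: E_tensor_def E_right_class additive_def)

lemma hermitian_bimodule_mapD: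
  assumes "\<Phi> \<in> hermitian_bimodule_maps sD star sH act"
  shows "\<Phi> \<in> extensional (E_space sH)"
    and "z \<in> E_space sH \<Longrightarrow> w \<in> E_space sH \<Longrightarrow> \<Phi> (E_add sH z w) = \<Phi> z + \<Phi> w"
    and "z \<in> E_space sH \<Longrightarrow> \<Phi> (E_scale sH \<alpha> z) = sD \<alpha> (\<Phi> z)"
    and "z \<in> E_space sH \<Longrightarrow> \<Phi> (E_right sH act z d) = \<Phi> z * d"
    and "z \<in> E_space sH \<Longrightarrow> star (\<Phi> z) = \<Phi> (E_inv sH z)"
  using assms unfolding hermitian_bimodule_maps_def by blast+

lemma inner_product_of_map:
  assumes \<Phi>: "\<Phi> \<in> hermitian_bimodule_maps sD star sH act"
  shows "(\<lambda>x y. \<Phi> (E_tensor sH x y)) \<in> inner_products sD star sH act"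
proof -
  let ?ip = "\<lambda>x y. \<Phi> (E_tensor sH x y)"
  have "?ip x (y + y') = ?ip x y + ?ip x y'" "?ip (x + x') y = ?ip x y + ?ip x' y"
    "?ip x (sH \<alpha> y) = sD \<alpha> (?ip x y)" "?ip (sH \<alpha> x) y = sD (adj_conj \<alpha>) (?ip x y)"
    for \<alpha> x x' y y'
    by (simp_all add: hermitian_bimodule_mapD(2,3)[OF \<Phi>] E_tensor_add_left E_tensor_add_right
        E_tensor_scale_left E_tensor_scale_right)
  moreover have "?ip x y = star (?ip y x)" for x y
    by (simp add: hermitian_bimodule_mapD(5)[OF \<Phi>] E_inv_tensor)
  moreover have "?ip x (act y d) = ?ip x y * d" for x y d
    by (simp add: hermitian_bimodule_mapD(4)[OF \<Phi>] flip: E_right_tensor)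
  ultimately show ?thesis
    unfolding inner_products_def by blast
qed

lemma additive_map_class:
  assumes \<Phi>: "\<Phi> \<in> hermitian_bimodule_maps sD star sH act"
  shows "additive (\<lambda>f. \<Phi> (E_class sH f))"
  by (simp add: additive_def hermitian_bimodule_mapD(2)[OF \<Phi>] flip: E_add_class)

lemma hermitian_bimodule_map_eqI:
  assumes \<Phi>: "\<Phi> \<in> hermitian_bimodule_maps sD star sH act"
    and \<Psi>: "\<Psi> \<in> hermitian_bimodule_maps sD star sH act"
    and eq: "\<And>x y. \<Phi> (E_tensor sH x y) = \<Psi> (E_tensor sH x y)"
  shows "\<Phi> = \<Psi>"
proof (rule extensionalityI)
  fix z assume "z \<in> E_space sH"
  then obtain f where z: "z = E_class sH f"
    by (rule E_space_cases)
  have "\<Phi> (E_class sH f) = \<Psi> (E_class sH f)"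
    by (rule additive_free_eqI[OF additive_map_class[OF \<Phi>] additive_map_class[OF \<Psi>]])
      (auto simp del: E_scale_class
        simp: E_class_single hermitian_bimodule_mapD(3)[OF \<Phi>] hermitian_bimodule_mapD(3)[OF \<Psi>] eq)
  then show "\<Phi> z = \<Psi> z"
    by (simp add: z)
qed (fact hermitian_bimodule_mapD(1)[OF \<Phi>] hermitian_bimodule_mapD(1)[OF \<Psi>])+

section \<open>From inner products to bimodule maps\<close>

definition ip_linear :: "('h \<Rightarrow> 'h \<Rightarrow> 'd) \<Rightarrow> ('r, 'h) free_hh \<Rightarrow> 'd" where
  "ip_linear ip = free_extend (\<lambda>(x, y) c. sD c (ip x y))"

lemma additive_ip_term: "additive ((\<lambda>(x, y) c. sD c (ip x y)) k)"
  by (cases k) (simp add: additive_def D.scale_left_distrib)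

lemma additive_ip_linear: "additive (ip_linear ip)"
  unfolding ip_linear_def by (intro additive_free_extend additive_ip_term)

lemma ip_linear_single [simp]: "ip_linear ip (Poly_Mapping.single (x, y) c) = sD c (ip x y)"
  unfolding ip_linear_def by (subst free_extend_single[OF additive_ip_term]) simp

lemma additive_comp: "additive F \<Longrightarrow> additive G \<Longrightarrow> additive (\<lambda>u. F (G u))"
  by (simp add: additive_def)

lemma ip_linear_scale: "ip_linear ip (free_scale c f) = sD c (ip_linear ip f)"
  by (rule additive_free_eqI[where F = "\<lambda>f. ip_linear ip (free_scale c f)"])
    (auto simp: additive_def additive.add[OF additive_ip_linear] free.scale_right_distrib
      D.scale_right_distrib)

lemma inner_productD:
  assumes "ip \<in> inner_products sD star sH act"
  shows "ip x (y + y') = ip x y + ip x y'" "ip (x + x') y = ip x y + ip x' y"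
    "ip x (sH \<alpha> y) = sD \<alpha> (ip x y)" "ip (sH \<alpha> x) y = sD (adj_conj \<alpha>) (ip x y)"
    "ip y x = star (ip x y)" "ip x (act y d) = ip x y * d"
  using assms unfolding inner_products_def by blast+

text \<open>Left linearity of the induced map comes from right linearity by applying the hermitian
  symmetry twice.\<close>

lemma inner_product_left:
  assumes ip: "ip \<in> inner_products sD star sH act"
  shows "ip (act x (star d)) y = d * ip x y"
proof -
  have "ip (act x (star d)) y = star (ip y x * star d)"
    by (simp add: inner_productD(5)[OF ip, symmetric] inner_productD(6)[OF ip, symmetric])
  also have "\<dots> = d * ip x y"
    by (simp add: D.star_mult D.star_star inner_productD(5)[OF ip, symmetric])
  finally show ?thesis .
qed

lemma ip_linear_relations:
  assumes ip: "ip \<in> inner_products sD star sH act" and f: "f \<in> E_relations sH"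
  shows "ip_linear ip f = 0"
proof -
  interpret L: additive "ip_linear ip"
    by (fact additive_ip_linear)
  have "ip_linear ip f \<in> {0}"
    using f
  proof (rule span_into_subspace[where s = sD and t = id, rotated -1])
    fix u assume "u \<in> tensor_relators (conj_scale sH) sH"
    then show "ip_linear ip u \<in> {0}"
      by (cases rule: tensor_relators_cases)
        (simp_all add: L.diff inner_productD(1-4)[OF ip] conj_scale_def)
  qed (auto simp: D.module_axioms additive_ip_linear)
  then show ?thesis by simp
qed

text \<open>The chosen representative is immaterial by \<open>ip_linear_relations\<close>.\<close>

definition map_of_ip :: "('h \<Rightarrow> 'h \<Rightarrow> 'd) \<Rightarrow> ('r, 'h) free_hh set \<Rightarrow> 'd" where
  "map_of_ip ip = restrict (\<lambda>z. ip_linear ip (SOME f. f \<in> z)) (E_space sH)"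

lemma map_of_ip_class:
  assumes ip: "ip \<in> inner_products sD star sH act"
  shows "map_of_ip ip (E_class sH f) = ip_linear ip f"
proof -
  have "(SOME g. g \<in> E_class sH f) \<in> E_class sH f"
    by (rule someI) (rule E_class_self)
  then have "ip_linear ip (f - (SOME g. g \<in> E_class sH f)) = 0"
    by (intro ip_linear_relations[OF ip]) (simp add: E_class_iff)
  then show ?thesis
    by (simp add: map_of_ip_def additive.diff[OF additive_ip_linear])
qed

lemma map_of_ip_tensor:
  "ip \<in> inner_products sD star sH act \<Longrightarrow> map_of_ip ip (E_tensor sH x y) = ip x y"
  by (simp add: E_tensor_def map_of_ip_class)

lemma map_of_ip_hermitian:
  assumes ip: "ip \<in> inner_products sD star sH act"
  shows "map_of_ip ip \<in> hermitian_bimodule_maps sD star sH act"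
proof -
  interpret L: additive "ip_linear ip"
    by (fact additive_ip_linear)
  have id: "additive (id :: 'r adjoin_i \<Rightarrow> _)" and conj: "additive (adj_conj :: 'r adjoin_i \<Rightarrow> _)"
    by (simp_all add: additive_def)
  note push = additive_comp[OF additive_ip_linear additive_free_push]
  have left: "ip_linear ip (free_push (\<lambda>(x, y). (conj_act star act d x, y)) id f) =
      d * ip_linear ip f" for d f
  proof (rule additive_free_eqI[OF push[OF id]])
    show "additive (\<lambda>f. d * ip_linear ip f)"
      by (simp add: additive_def L.add distrib_left)
  qed (auto simp: id conj_act_def inner_product_left[OF ip] D.scale_mult_right)
  have right: "ip_linear ip (free_push (\<lambda>(x, y). (x, act y d)) id f) = ip_linear ip f * d"
    for d f
  proof (rule additive_free_eqI[OF push[OF id]])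
    show "additive (\<lambda>f. ip_linear ip f * d)"
      by (simp add: additive_def L.add distrib_right)
  qed (auto simp: id inner_productD(6)[OF ip] D.scale_mult_left)
  have inv: "ip_linear ip (free_push (\<lambda>(x, y). (y, x)) adj_conj f) = star (ip_linear ip f)" for f
  proof (rule additive_free_eqI[OF push[OF conj]])
    show "additive (\<lambda>f. star (ip_linear ip f))"
      by (simp add: additive_def L.add D.star_add)
  qed (auto simp: conj D.star_scale inner_productD(5)[OF ip, symmetric])
  have "map_of_ip ip \<in> extensional (E_space sH)"
    by (simp add: map_of_ip_def)
  moreover have "map_of_ip ip (E_add sH z w) = map_of_ip ip z + map_of_ip ip w"
    if "z \<in> E_space sH" "w \<in> E_space sH" for z w
    using that by (metis E_space_cases E_add_class map_of_ip_class[OF ip] L.add)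
  moreover have "map_of_ip ip (E_scale sH \<alpha> z) = sD \<alpha> (map_of_ip ip z)"
    "map_of_ip ip (E_left star sH act d z) = d * map_of_ip ip z"
    "map_of_ip ip (E_right sH act z d) = map_of_ip ip z * d"
    "star (map_of_ip ip z) = map_of_ip ip (E_inv sH z)"
    if z: "z \<in> E_space sH" for \<alpha> d z
  proof -
    obtain f where "z = E_class sH f"
      using z by (rule E_space_cases)
    then show "map_of_ip ip (E_scale sH \<alpha> z) = sD \<alpha> (map_of_ip ip z)"
      "map_of_ip ip (E_left star sH act d z) = d * map_of_ip ip z"
      "map_of_ip ip (E_right sH act z d) = map_of_ip ip z * d"
      "star (map_of_ip ip z) = map_of_ip ip (E_inv sH z)"
      by (simp_all add: map_of_ip_class[OF ip] ip_linear_scale E_left_class E_right_class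
          E_inv_class left right inv)
  qed
  ultimately show ?thesis
    unfolding hermitian_bimodule_maps_def by blast
qed

lemma bimodule_maps_bij_inner_products:
  "bij_betw (\<lambda>\<Phi> x y. \<Phi> (E_tensor sH x y))
    (hermitian_bimodule_maps sD star sH act) (inner_products sD star sH act)"
proof (rule bij_betw_byWitness[where f' = map_of_ip])
  let ?ip = "\<lambda>\<Phi> x y. \<Phi> (E_tensor sH x y)"
  show "\<forall>\<Phi>\<in>hermitian_bimodule_maps sD star sH act. map_of_ip (?ip \<Phi>) = \<Phi>"
  proof
    fix \<Phi> assume \<Phi>: "\<Phi> \<in> hermitian_bimodule_maps sD star sH act"
    note ip = inner_product_of_map[OF \<Phi>]
    show "map_of_ip (?ip \<Phi>) = \<Phi>"
      by (rule hermitian_bimodule_map_eqI[OF map_of_ip_hermitian[OF ip] \<Phi>])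
        (rule map_of_ip_tensor[OF ip])
  qed
  show "\<forall>ip\<in>inner_products sD star sH act. ?ip (map_of_ip ip) = ip"
    by (simp add: map_of_ip_tensor)
  show "?ip ` hermitian_bimodule_maps sD star sH act \<subseteq> inner_products sD star sH act"
    using inner_product_of_map by blast
  show "map_of_ip ` inner_products sD star sH act \<subseteq> hermitian_bimodule_maps sD star sH act"
    using map_of_ip_hermitian by blast
qed

section \<open>Complete positivity\<close>

lemma E_sum_class: "E_sum sH m (\<lambda>k. E_class sH (f k)) = E_class sH (\<Sum>k<m. f k)"
  by (induction m) (simp_all add: E_zero_def)

lemma map_E_sum:
  assumes \<Phi>: "\<Phi> \<in> hermitian_bimodule_maps sD star sH act"
  shows "\<Phi> (E_sum sH m (\<lambda>k. E_scale sH (c k) (E_tensor sH (x k) (y k)))) =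
    (\<Sum>k<m. sD (c k) (\<Phi> (E_tensor sH (x k) (y k))))"
  using additive.sum[OF additive_map_class[OF \<Phi>],
      of "\<lambda>k. Poly_Mapping.single (x k, y k) (c k)" "{..<m}"]
  by (simp add: hermitian_bimodule_mapD(3)[OF \<Phi>] E_class_single del: E_scale_class
      flip: E_sum_class)

lemma positive_matrices_sum:
  fixes m :: nat
  assumes "\<And>k. k < m \<Longrightarrow> 0 \<le> \<alpha> k"
    and "\<And>k. k < m \<Longrightarrow> mat n n (A k) \<in> positive_matrices sD star n"
  shows "mat n n (\<lambda>ij. \<Sum>k<m. sD (adj_of (\<alpha> k)) (A k ij)) \<in> positive_matrices sD star n"
  using assms
proof (induction m)
  case 0
  have "mat n n (\<lambda>ij. 0 :: 'd) = 0\<^sub>m n n"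
    by (rule eq_matI) simp_all
  then show ?case
    by (simp add: D.positive_matrices_zero)
next
  case (Suc m)
  have "mat n n (\<lambda>ij. \<Sum>k<Suc m. sD (adj_of (\<alpha> k)) (A k ij)) =
      mat n n (\<lambda>ij. \<Sum>k<m. sD (adj_of (\<alpha> k)) (A k ij)) +
      map_mat (sD (adj_of (\<alpha> m))) (mat n n (A m))"
    by (rule eq_matI) simp_all
  then show ?case
    using Suc by (simp add: positive_matrices_add positive_matrices_scale)
qed

text \<open>By linearity the image of an element of \<open>\<K>\<^sub>n\<close> is the same combination of Gram matrices.\<close>

lemma completely_positive_map_of_ip:
  assumes \<Phi>: "\<Phi> \<in> hermitian_bimodule_maps sD star sH act"
    and cp: "completely_positive_ip sD star (\<lambda>x y. \<Phi> (E_tensor sH x y))"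
  shows "completely_positive_map sD star sH \<Phi>"
  unfolding completely_positive_map_def
proof (intro allI image_subsetI)
  fix n M assume "M \<in> convex_K sH n"
  then obtain m \<alpha> x where \<alpha>: "\<forall>k<m. 0 < \<alpha> k" and
    M: "M = mat n n (\<lambda>(i, j). E_sum sH m
      (\<lambda>k. E_scale sH (adj_of (\<alpha> k)) (E_tensor sH (x k i) (x k j))))"
    unfolding convex_K_def by blast
  have "map_mat \<Phi> M = mat n n (\<lambda>ij. \<Sum>k<m. sD (adj_of (\<alpha> k))
      ((\<lambda>(i, j). \<Phi> (E_tensor sH (x k i) (x k j))) ij))"
    unfolding M by (rule eq_matI) (simp_all add: map_E_sum[OF \<Phi>])
  also have "\<dots> \<in> positive_matrices sD star n"
    using \<alpha> cp unfolding completely_positive_ip_def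
    by (intro positive_matrices_sum) (auto intro: less_imp_le)
  finally show "map_mat \<Phi> M \<in> positive_matrices sD star n" .
qed

text \<open>Every Gram matrix is the image of a one-term combination with coefficient 1.\<close>

lemma completely_positive_ip_of_map:
  assumes \<Phi>: "\<Phi> \<in> hermitian_bimodule_maps sD star sH act"
    and cp: "completely_positive_map sD star sH \<Phi>"
  shows "completely_positive_ip sD star (\<lambda>x y. \<Phi> (E_tensor sH x y))"
  unfolding completely_positive_ip_def
proof (intro allI)
  fix n and x :: "nat \<Rightarrow> 'h"
  define M where "M = mat n n (\<lambda>(i, j). E_sum sH (Suc 0)
      (\<lambda>k. E_scale sH (adj_of 1) (E_tensor sH (x i) (x j))))"
  \<comment> \<open>In an ordered ring \<open>0 < 1\<close> because \<open>1\<close> is a nonzero square.\<close>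
  have "\<forall>k<Suc 0. (0::'r) < 1"
    using zero_le_square[of "1::'r"] by (simp add: less_le)
  then have "M \<in> convex_K sH n"
    unfolding M_def convex_K_def
    by (intro CollectI exI[of _ "Suc 0"] exI[of _ "\<lambda>_. 1"] exI[of _ "\<lambda>_. x"] conjI refl)
  then have "map_mat \<Phi> M \<in> positive_matrices sD star n"
    using cp unfolding completely_positive_map_def by blast
  moreover have "adj_of 1 = (1 :: 'r adjoin_i)"
    by (simp add: adj_of_def one_adjoin_i_def)
  then have "map_mat \<Phi> M = mat n n (\<lambda>(i, j). \<Phi> (E_tensor sH (x i) (x j)))"
    unfolding M_def by (intro eq_matI) (simp_all add: map_E_sum[OF \<Phi>] del: E_sum.simps)
  ultimately show "mat n n (\<lambda>(i, j). \<Phi> (E_tensor sH (x i) (x j))) \<in> positive_matrices sD star n"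
    by simp
qed

end

theorem proposition4p1:
  fixes sD :: "'r::{comm_ring_1, linordered_ring} adjoin_i \<Rightarrow> 'd::ring \<Rightarrow> 'd"
    and star :: "'d \<Rightarrow> 'd"
    and sH :: "'r adjoin_i \<Rightarrow> 'h::ab_group_add \<Rightarrow> 'h"
    and act :: "'h \<Rightarrow> 'd \<Rightarrow> 'h"
  assumes "right_star_module sD star sH act"
  shows "bij_betw (\<lambda>\<Phi> x y. \<Phi> (E_tensor sH x y))
           (hermitian_bimodule_maps sD star sH act) (inner_products sD star sH act) \<and>
         (\<forall>\<Phi> \<in> hermitian_bimodule_maps sD star sH act.
           completely_positive_ip sD star (\<lambda>x y. \<Phi> (E_tensor sH x y)) \<longleftrightarrow>
           completely_positive_map sD star sH \<Phi>)"
proof -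
  interpret right_star_module sD star sH act
    by (fact assms)
  show ?thesis
    using bimodule_maps_bij_inner_products completely_positive_map_of_ip
      completely_positive_ip_of_map by blast
qed

end
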